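(* The adjacency digraph is a functor from the category of (filtered) stratified real algebraic varieties with finite stratifications (finite at each level) to the category of (filtered) digraphs. Here a morphism $\zeta$ of stratified varieties is sent to the map $Adj(\zeta)$ on strata taking a stratum $s$ to the stratum containing $\zeta(s)$, and a filtered stratified variety $(R_0,S_0)\xrightarrow{\lambda_0}(R_1,S_1)\xrightarrow{\lambda_1}\cdots$ is sent to the filtered digraph $Adj((R_0,S_0))\xrightarrow{Adj(\lambda_0)}Adj((R_1,S_1))\xrightarrow{Adj(\lambda_1)}\cdots$.
   Context: A stratified real algebraic variety is a real algebraic variety with a partition into (non-empty) semialgebraic sets called strata. A filtered stratified real algebraic variety is a sequence of closed embeddings $R_0\xrightarrow{\lambda_0}R_1\xrightarrow{\lambda_1}\cdots$ of real algebraic varieties with a stratification $S_i$ of each $R_i$ such that for every $s\in S_i$ there is $\tilde s\in S_{i+1}$ with $\lambda_i(s)\subset\tilde s$ and $\tilde s\cap\lambda_i(R_i)=\lambda_i(s)$. A morphism is a sequence of morphisms of real algebraic varieties commuting with the embeddings, mapping each stratum into a stratum, and such that the images of any two strata of the same level are equal or disjoint (in the unfiltered case, a single such morphism). The adjacency digraph $Adj((R,S))$ of a variety with finite stratification has the strata as vertices, and an edge $(s,t)$ iff $\overline s\cap t\ne\varnothing$ (Euclidean closure). A filtered digraph is a sequence of embeddings (injective-on-vertices digraph morphisms) $G_0\to G_1\to\cdots$; morphisms of filtered digraphs are sequences of digraph morphisms commuting with these. A digraph morphism is a map of vertices sending edges to edges.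
   Formalization: Morphisms of (filtered) stratified varieties, as defined, are not closed under composition (images of strata may stop being equal or disjoint), so the source category is taken to be the one generated by them: same objects, arrows are finite composites of morphisms. *)

theory Defs
  imports "HOL-Analysis.Analysis" "Graph_Theory.Pair_Digraph"
begin

section \<open>Categories and functors\<close>

record ('o, 'm) cat =
  obj :: "'o set"
  hom :: "'o \<Rightarrow> 'o \<Rightarrow> 'm set"
  ident :: "'o \<Rightarrow> 'm"
  compos :: "'o \<Rightarrow> 'o \<Rightarrow> 'o \<Rightarrow> 'm \<Rightarrow> 'm \<Rightarrow> 'm"

text \<open>\<^term>\<open>compos \<C> A B C g f\<close> is the composite of \<open>f\<close> from \<open>A\<close> to \<open>B\<close> with \<open>g\<close> from
  \<open>B\<close> to \<open>C\<close>.\<close>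

definition is_category :: "('o, 'm) cat \<Rightarrow> bool" where
  "is_category \<C> \<longleftrightarrow>
     (\<forall>A\<in>obj \<C>. ident \<C> A \<in> hom \<C> A A) \<and>
     (\<forall>A\<in>obj \<C>. \<forall>B\<in>obj \<C>. \<forall>C\<in>obj \<C>. \<forall>f\<in>hom \<C> A B. \<forall>g\<in>hom \<C> B C.
        compos \<C> A B C g f \<in> hom \<C> A C) \<and>
     (\<forall>A\<in>obj \<C>. \<forall>B\<in>obj \<C>. \<forall>f\<in>hom \<C> A B.
        compos \<C> A A B f (ident \<C> A) = f \<and> compos \<C> A B B (ident \<C> B) f = f) \<and>
     (\<forall>A\<in>obj \<C>. \<forall>B\<in>obj \<C>. \<forall>C\<in>obj \<C>. \<forall>D\<in>obj \<C>.
        \<forall>f\<in>hom \<C> A B. \<forall>g\<in>hom \<C> B C. \<forall>h\<in>hom \<C> C D.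
        compos \<C> A C D h (compos \<C> A B C g f) = compos \<C> A B D (compos \<C> B C D h g) f)"

definition is_functor ::
  "('o, 'm) cat \<Rightarrow> ('p, 'n) cat \<Rightarrow> ('o \<Rightarrow> 'p) \<Rightarrow> ('o \<Rightarrow> 'o \<Rightarrow> 'm \<Rightarrow> 'n) \<Rightarrow> bool" where
  "is_functor \<C> \<D> F F' \<longleftrightarrow>
     is_category \<C> \<and> is_category \<D> \<and>
     (\<forall>A\<in>obj \<C>. F A \<in> obj \<D>) \<and>
     (\<forall>A\<in>obj \<C>. \<forall>B\<in>obj \<C>. \<forall>f\<in>hom \<C> A B. F' A B f \<in> hom \<D> (F A) (F B)) \<and>
     (\<forall>A\<in>obj \<C>. F' A A (ident \<C> A) = ident \<D> (F A)) \<and>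
     (\<forall>A\<in>obj \<C>. \<forall>B\<in>obj \<C>. \<forall>C\<in>obj \<C>. \<forall>f\<in>hom \<C> A B. \<forall>g\<in>hom \<C> B C.
        F' A C (compos \<C> A B C g f) = compos \<D> (F A) (F B) (F C) (F' B C g) (F' A B f))"

text \<open>Closure of the hom-sets under identities and composition. If the given hom-sets already
  form a category, nothing changes.\<close>

inductive generated_arrow :: "('o, 'm) cat \<Rightarrow> 'o \<Rightarrow> 'o \<Rightarrow> 'm \<Rightarrow> bool" for \<C> where
  arrow: "\<lbrakk>A \<in> obj \<C>; B \<in> obj \<C>; f \<in> hom \<C> A B\<rbrakk> \<Longrightarrow> generated_arrow \<C> A B f"
| ident: "A \<in> obj \<C> \<Longrightarrow> generated_arrow \<C> A A (ident \<C> A)"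
| compos: "\<lbrakk>generated_arrow \<C> A B f; generated_arrow \<C> B C g\<rbrakk>
          \<Longrightarrow> generated_arrow \<C> A C (compos \<C> A B C g f)"

definition generated_category :: "('o, 'm) cat \<Rightarrow> ('o, 'm) cat" where
  "generated_category \<C> = \<C>\<lparr>hom := \<lambda>A B. {f. generated_arrow \<C> A B f}\<rparr>"

lemma generated_arrow_objD:
  "generated_arrow \<C> A B f \<Longrightarrow> A \<in> obj \<C> \<and> B \<in> obj \<C>"
  by (induction rule: generated_arrow.induct) auto

lemma generated_arrow_id:
  assumes "is_category \<C>"
  shows "generated_arrow \<C> A B f \<longleftrightarrow> A \<in> obj \<C> \<and> B \<in> obj \<C> \<and> f \<in> hom \<C> A B"
proof
  show "generated_arrow \<C> A B f \<Longrightarrow> A \<in> obj \<C> \<and> B \<in> obj \<C> \<and> f \<in> hom \<C> A B"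
    by (induction rule: generated_arrow.induct) (use assms in \<open>auto simp: is_category_def\<close>)
qed (auto intro: generated_arrow.arrow)

section \<open>Real algebraic varieties\<close>

text \<open>Points of affine \<open>n\<close>-space are the points of \<^term>\<open>Euclidean_space n\<close>: sequences vanishing
  at all indices \<open>\<ge> n\<close>.\<close>

abbreviation aff :: "nat \<Rightarrow> (nat \<Rightarrow> real) set" where
  "aff n \<equiv> topspace (Euclidean_space n)"

inductive polynomial_fun :: "nat \<Rightarrow> ((nat \<Rightarrow> real) \<Rightarrow> real) \<Rightarrow> bool" for n where
  const: "polynomial_fun n (\<lambda>x. c)"
| coord: "i < n \<Longrightarrow> polynomial_fun n (\<lambda>x. x i)"
| add: "\<lbrakk>polynomial_fun n p; polynomial_fun n q\<rbrakk> \<Longrightarrow> polynomial_fun n (\<lambda>x. p x + q x)"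
| mult: "\<lbrakk>polynomial_fun n p; polynomial_fun n q\<rbrakk> \<Longrightarrow> polynomial_fun n (\<lambda>x. p x * q x)"

definition zero_set :: "nat \<Rightarrow> ((nat \<Rightarrow> real) \<Rightarrow> real) set \<Rightarrow> (nat \<Rightarrow> real) set" where
  "zero_set n P = {x \<in> aff n. \<forall>p\<in>P. p x = 0}"

definition real_algebraic_set :: "nat \<Rightarrow> (nat \<Rightarrow> real) set \<Rightarrow> bool" where
  "real_algebraic_set n V \<longleftrightarrow> (\<exists>P \<subseteq> Collect (polynomial_fun n). V = zero_set n P)"

inductive semialgebraic :: "nat \<Rightarrow> (nat \<Rightarrow> real) set \<Rightarrow> bool" for n where
  pos: "polynomial_fun n p \<Longrightarrow> semialgebraic n {x \<in> aff n. p x > 0}"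
| union: "\<lbrakk>semialgebraic n A; semialgebraic n B\<rbrakk> \<Longrightarrow> semialgebraic n (A \<union> B)"
| inter: "\<lbrakk>semialgebraic n A; semialgebraic n B\<rbrakk> \<Longrightarrow> semialgebraic n (A \<inter> B)"
| compl: "semialgebraic n A \<Longrightarrow> semialgebraic n (aff n - A)"

definition affine_zariski :: "nat \<Rightarrow> (nat \<Rightarrow> real) topology" where
  "affine_zariski n = topology (\<lambda>U. U \<subseteq> aff n \<and> real_algebraic_set n (aff n - U))"

lemma openin_affine_zariski:
  "openin (affine_zariski n) U \<longleftrightarrow> U \<subseteq> aff n \<and> real_algebraic_set n (aff n - U)"
proof -
  have ix: "real_algebraic_set n (aff n - S \<inter> T)"
    if S: "real_algebraic_set n (aff n - S)" and T: "real_algebraic_set n (aff n - T)" for S T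
  proof -
    obtain P where P: "P \<subseteq> Collect (polynomial_fun n)" "aff n - S = zero_set n P"
      using S unfolding real_algebraic_set_def by blast
    obtain Q where Q: "Q \<subseteq> Collect (polynomial_fun n)" "aff n - T = zero_set n Q"
      using T unfolding real_algebraic_set_def by blast
    define R where "R = (\<lambda>(p, q) x. p x * q x) ` (P \<times> Q)"
    have "R \<subseteq> Collect (polynomial_fun n)"
      using P(1) Q(1) unfolding R_def by (auto intro!: polynomial_fun.mult)
    moreover have "zero_set n P \<union> zero_set n Q = zero_set n R"
    proof
      show "zero_set n P \<union> zero_set n Q \<subseteq> zero_set n R"
        by (auto simp: zero_set_def R_def)
      show "zero_set n R \<subseteq> zero_set n P \<union> zero_set n Q"
      proof
        fix x assume x: "x \<in> zero_set n R"
        then have "p x = 0 \<or> q x = 0" if "p \<in> P" "q \<in> Q" for p q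
          using that by (auto simp: zero_set_def R_def)
        then have "(\<forall>p\<in>P. p x = 0) \<or> (\<forall>q\<in>Q. q x = 0)" by blast
        moreover have "x \<in> aff n" using x by (simp add: zero_set_def)
        ultimately show "x \<in> zero_set n P \<union> zero_set n Q" by (simp add: zero_set_def)
      qed
    qed
    moreover have "aff n - S \<inter> T = zero_set n P \<union> zero_set n Q"
      unfolding P(2)[symmetric] Q(2)[symmetric] by (rule Diff_Int)
    ultimately show ?thesis unfolding real_algebraic_set_def by (intro exI[of _ R] conjI) simp_all
  qed
  have un: "real_algebraic_set n (aff n - \<Union>K)"
    if K: "\<And>U. U \<in> K \<Longrightarrow> real_algebraic_set n (aff n - U)" for K
  proof -
    define R where "R = {p. polynomial_fun n p \<and> (\<forall>x\<in>aff n - \<Union>K. p x = 0)}"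
    have "x \<notin> \<Union>K" if x: "x \<in> zero_set n R" for x
    proof
      assume "x \<in> \<Union>K"
      then obtain U where U: "U \<in> K" "x \<in> U" by (rule UnionE)
      obtain P where P: "P \<subseteq> Collect (polynomial_fun n)" "aff n - U = zero_set n P"
        using K[OF U(1)] unfolding real_algebraic_set_def by (elim exE conjE)
      have "p \<in> R" if "p \<in> P" for p
      proof -
        have "p y = 0" if "y \<in> aff n - \<Union>K" for y
        proof -
          have "y \<in> zero_set n P" using that U(1) unfolding P(2)[symmetric] by blast
          then show ?thesis using \<open>p \<in> P\<close> by (simp add: zero_set_def)
        qed
        moreover have "polynomial_fun n p" using P(1) \<open>p \<in> P\<close> by (rule CollectD[OF subsetD])
        ultimately show ?thesis by (simp add: R_def)
      qed
      then have "x \<in> zero_set n P" using x by (simp add: zero_set_def)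
      then have "x \<notin> U" unfolding P(2)[symmetric] by blast
      then show False using U(2) by contradiction
    qed
    then have "zero_set n R \<subseteq> aff n - \<Union>K" by (simp add: zero_set_def subset_iff)
    moreover have "aff n - \<Union>K \<subseteq> zero_set n R" by (simp add: zero_set_def R_def subset_iff)
    ultimately have "aff n - \<Union>K = zero_set n R" by (rule equalityI[rotated])
    moreover have "R \<subseteq> Collect (polynomial_fun n)" unfolding R_def by blast
    ultimately show ?thesis unfolding real_algebraic_set_def by (intro exI[of _ R] conjI)
  qed
  have "istopology (\<lambda>U. U \<subseteq> aff n \<and> real_algebraic_set n (aff n - U))"
    unfolding istopology_def
  proof (intro conjI allI impI)
    fix K assume "\<forall>U\<in>K. U \<subseteq> aff n \<and> real_algebraic_set n (aff n - U)"
    then show "\<Union>K \<subseteq> aff n" and "real_algebraic_set n (aff n - \<Union>K)"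
      by (simp_all only: Union_least un)
  qed (simp_all only: ix le_infI1)
  then show ?thesis unfolding affine_zariski_def by (simp only: topology_inverse')
qed

text \<open>Real algebraic varieties are taken in the sense of Bochnak, Coste and Roy: spaces carrying a
  sheaf of real-valued functions that are locally isomorphic, over a finite open cover, to real
  algebraic sets. Functions on \<open>U\<close> are made extensional so that they are determined by their
  values on \<open>U\<close>.\<close>

record 'a fspace =
  zariski :: "'a topology"
  regular :: "'a set \<Rightarrow> ('a \<Rightarrow> real) set"

abbreviation points :: "'a fspace \<Rightarrow> 'a set" where
  "points X \<equiv> topspace (zariski X)"

definition sheaf_of_functions :: "'a fspace \<Rightarrow> bool" where
  "sheaf_of_functions X \<longleftrightarrow>
     (\<forall>U. openin (zariski X) U \<longrightarrow> regular X U \<subseteq> extensional U) \<and>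
     (\<forall>U V f. openin (zariski X) U \<and> openin (zariski X) V \<and> V \<subseteq> U \<and> f \<in> regular X U \<longrightarrow>
        restrict f V \<in> regular X V) \<and>
     (\<forall>U. \<forall>f\<in>extensional U. openin (zariski X) U \<and>
        (\<forall>x\<in>U. \<exists>V. openin (zariski X) V \<and> x \<in> V \<and> V \<subseteq> U \<and> restrict f V \<in> regular X V) \<longrightarrow>
        f \<in> regular X U)"

definition affine_space :: "nat \<Rightarrow> (nat \<Rightarrow> real) fspace" where
  "affine_space n = \<lparr>
     zariski = affine_zariski n,
     regular = (\<lambda>U. {f \<in> extensional U. \<forall>x\<in>U. \<exists>N p q.
        openin (affine_zariski n) N \<and> x \<in> N \<and> N \<subseteq> U \<and> polynomial_fun n p \<and> polynomial_fun n q \<and>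
        (\<forall>y\<in>N. q y \<noteq> 0 \<and> f y = p y / q y)})\<rparr>"

text \<open>A subset carries the subspace topology and the functions that locally extend to regular
  functions of the ambient space. For an open subset this is the restriction of the sheaf.\<close>

definition subfspace :: "'a fspace \<Rightarrow> 'a set \<Rightarrow> 'a fspace" where
  "subfspace X A = \<lparr>
     zariski = subtopology (zariski X) A,
     regular = (\<lambda>W. {f \<in> extensional W. \<forall>x\<in>W. \<exists>N g.
        openin (zariski X) N \<and> x \<in> N \<and> N \<inter> A \<subseteq> W \<and> g \<in> regular X N \<and>
        (\<forall>y\<in>N \<inter> A. f y = g y)})\<rparr>"

definition regular_map :: "'a fspace \<Rightarrow> 'b fspace \<Rightarrow> ('a \<Rightarrow> 'b) \<Rightarrow> bool" where
  "regular_map X Y f \<longleftrightarrow>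
     f \<in> points X \<rightarrow>\<^sub>E points Y \<and>
     continuous_map (zariski X) (zariski Y) f \<and>
     (\<forall>U h. openin (zariski Y) U \<and> h \<in> regular Y U \<longrightarrow>
        compose {x \<in> points X. f x \<in> U} h f \<in> regular X {x \<in> points X. f x \<in> U})"

definition regular_iso :: "'a fspace \<Rightarrow> 'b fspace \<Rightarrow> ('a \<Rightarrow> 'b) \<Rightarrow> bool" where
  "regular_iso X Y f \<longleftrightarrow> regular_map X Y f \<and>
     (\<exists>g. regular_map Y X g \<and> (\<forall>x\<in>points X. g (f x) = x) \<and> (\<forall>y\<in>points Y. f (g y) = y))"

definition affine_chart :: "'a fspace \<Rightarrow> 'a set \<Rightarrow> nat \<Rightarrow> ('a \<Rightarrow> nat \<Rightarrow> real) \<Rightarrow> bool" where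
  "affine_chart X U n \<phi> \<longleftrightarrow> openin (zariski X) U \<and>
     (\<exists>V. real_algebraic_set n V \<and> regular_iso (subfspace X U) (subfspace (affine_space n) V) \<phi>)"

definition real_variety :: "'a fspace \<Rightarrow> bool" where
  "real_variety X \<longleftrightarrow> sheaf_of_functions X \<and>
     (\<exists>\<U>. finite \<U> \<and> \<Union>\<U> = points X \<and> (\<forall>U\<in>\<U>. \<exists>n \<phi>. affine_chart X U n \<phi>))"

definition closed_embedding :: "'a fspace \<Rightarrow> 'b fspace \<Rightarrow> ('a \<Rightarrow> 'b) \<Rightarrow> bool" where
  "closed_embedding X Y f \<longleftrightarrow> regular_map X Y f \<and> closedin (zariski Y) (f ` points X) \<and>
     regular_iso X (subfspace Y (f ` points X)) f"

text \<open>The Euclidean topology of a variety is glued from the Euclidean topologies of its affine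
  charts.\<close>

definition euclidean :: "'a fspace \<Rightarrow> 'a topology" where
  "euclidean X = topology_generated_by
     {{x \<in> U. \<phi> x \<in> T} | U n \<phi> T. affine_chart X U n \<phi> \<and> openin (Euclidean_space n) T}"

definition semialgebraic_subset :: "'a fspace \<Rightarrow> 'a set \<Rightarrow> bool" where
  "semialgebraic_subset X A \<longleftrightarrow> A \<subseteq> points X \<and>
     (\<forall>U n \<phi>. affine_chart X U n \<phi> \<longrightarrow> semialgebraic n (\<phi> ` (A \<inter> U)))"

section \<open>Stratified varieties\<close>

record 'a stratified =
  variety :: "'a fspace"
  strata :: "'a set set"

abbreviation pts :: "'a stratified \<Rightarrow> 'a set" where
  "pts R \<equiv> points (variety R)"

definition stratified_variety :: "'a stratified \<Rightarrow> bool" where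
  "stratified_variety R \<longleftrightarrow> real_variety (variety R) \<and>
     partition_on (pts R) (strata R) \<and> (\<forall>s\<in>strata R. semialgebraic_subset (variety R) s)"

definition stratified_morphism :: "'a stratified \<Rightarrow> 'b stratified \<Rightarrow> ('a \<Rightarrow> 'b) \<Rightarrow> bool" where
  "stratified_morphism R R' \<zeta> \<longleftrightarrow> regular_map (variety R) (variety R') \<zeta> \<and>
     (\<forall>s\<in>strata R. \<exists>s'\<in>strata R'. \<zeta> ` s \<subseteq> s') \<and>
     (\<forall>s\<in>strata R. \<forall>t\<in>strata R. \<zeta> ` s = \<zeta> ` t \<or> \<zeta> ` s \<inter> \<zeta> ` t = {})"

text \<open>Stratified morphisms are not closed under composition. Take finite sets of points as
  varieties, \<open>R = {a, b, c}\<close> with strata \<open>{a, b}\<close>, \<open>{c}\<close>; \<open>R' = {a, b, c, d}\<close> with strata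
  \<open>{a, b}\<close>, \<open>{c, d}\<close>; and \<open>R'' = {0, 1}\<close> with a single stratum. The inclusion of \<open>R\<close> into \<open>R'\<close> and
  the map \<open>a, c \<mapsto> 0\<close>, \<open>b, d \<mapsto> 1\<close> are stratified morphisms, but their composite maps the two
  strata of \<open>R\<close> onto \<open>{0, 1}\<close> and \<open>{0}\<close>. The category of stratified varieties is therefore the
  category generated by the stratified morphisms; the same applies to filtered ones.\<close>

definition stratified_arrows :: "('a stratified, 'a \<Rightarrow> 'a) cat" where
  "stratified_arrows = \<lparr>
     obj = {R. stratified_variety R \<and> finite (strata R)},
     hom = (\<lambda>R R'. {\<zeta>. stratified_morphism R R' \<zeta>}),
     ident = (\<lambda>R. \<lambda>x\<in>pts R. x),
     compos = (\<lambda>R R' R'' \<xi> \<zeta>. compose (pts R) \<xi> \<zeta>)\<rparr>"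

definition stratified_category :: "('a stratified, 'a \<Rightarrow> 'a) cat" where
  "stratified_category = generated_category stratified_arrows"

record 'a filtered_stratified =
  level :: "nat \<Rightarrow> 'a stratified"
  incl :: "nat \<Rightarrow> 'a \<Rightarrow> 'a"

definition filtered_stratified_variety :: "'a filtered_stratified \<Rightarrow> bool" where
  "filtered_stratified_variety F \<longleftrightarrow> (\<forall>i.
     stratified_variety (level F i) \<and>
     closed_embedding (variety (level F i)) (variety (level F (Suc i))) (incl F i) \<and>
     (\<forall>s\<in>strata (level F i). \<exists>s'\<in>strata (level F (Suc i)).
        incl F i ` s \<subseteq> s' \<and> s' \<inter> incl F i ` pts (level F i) = incl F i ` s))"

definition filtered_stratified_morphism ::
  "'a filtered_stratified \<Rightarrow> 'b filtered_stratified \<Rightarrow> (nat \<Rightarrow> 'a \<Rightarrow> 'b) \<Rightarrow> bool" where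
  "filtered_stratified_morphism F F' \<zeta> \<longleftrightarrow> (\<forall>i.
     stratified_morphism (level F i) (level F' i) (\<zeta> i) \<and>
     (\<forall>x\<in>pts (level F i). \<zeta> (Suc i) (incl F i x) = incl F' i (\<zeta> i x)))"

definition filtered_stratified_arrows :: "('a filtered_stratified, nat \<Rightarrow> 'a \<Rightarrow> 'a) cat" where
  "filtered_stratified_arrows = \<lparr>
     obj = {F. filtered_stratified_variety F \<and> (\<forall>i. finite (strata (level F i)))},
     hom = (\<lambda>F F'. {\<zeta>. filtered_stratified_morphism F F' \<zeta>}),
     ident = (\<lambda>F i. \<lambda>x\<in>pts (level F i). x),
     compos = (\<lambda>F F' F'' \<xi> \<zeta> i. compose (pts (level F i)) (\<xi> i) (\<zeta> i))\<rparr>"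

definition filtered_stratified_category :: "('a filtered_stratified, nat \<Rightarrow> 'a \<Rightarrow> 'a) cat" where
  "filtered_stratified_category = generated_category filtered_stratified_arrows"

section \<open>Digraphs\<close>

definition digraph_morphism :: "'v pair_pre_digraph \<Rightarrow> 'w pair_pre_digraph \<Rightarrow> ('v \<Rightarrow> 'w) \<Rightarrow> bool" where
  "digraph_morphism G H f \<longleftrightarrow> f \<in> pverts G \<rightarrow>\<^sub>E pverts H \<and>
     (\<forall>(u, v)\<in>parcs G. (f u, f v) \<in> parcs H)"

definition digraph_category :: "('v pair_pre_digraph, 'v \<Rightarrow> 'v) cat" where
  "digraph_category = \<lparr>
     obj = {G. pair_wf_digraph G},
     hom = (\<lambda>G H. {f. digraph_morphism G H f}),
     ident = (\<lambda>G. \<lambda>v\<in>pverts G. v),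
     compos = (\<lambda>G H K g f. compose (pverts G) g f)\<rparr>"

record 'v filtered_digraph =
  dlevel :: "nat \<Rightarrow> 'v pair_pre_digraph"
  dincl :: "nat \<Rightarrow> 'v \<Rightarrow> 'v"

definition is_filtered_digraph :: "'v filtered_digraph \<Rightarrow> bool" where
  "is_filtered_digraph F \<longleftrightarrow> (\<forall>i. pair_wf_digraph (dlevel F i) \<and>
     digraph_morphism (dlevel F i) (dlevel F (Suc i)) (dincl F i) \<and>
     inj_on (dincl F i) (pverts (dlevel F i)))"

definition filtered_digraph_morphism ::
  "'v filtered_digraph \<Rightarrow> 'w filtered_digraph \<Rightarrow> (nat \<Rightarrow> 'v \<Rightarrow> 'w) \<Rightarrow> bool" where
  "filtered_digraph_morphism F F' f \<longleftrightarrow> (\<forall>i.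
     digraph_morphism (dlevel F i) (dlevel F' i) (f i) \<and>
     (\<forall>v\<in>pverts (dlevel F i). f (Suc i) (dincl F i v) = dincl F' i (f i v)))"

definition filtered_digraph_category :: "('v filtered_digraph, nat \<Rightarrow> 'v \<Rightarrow> 'v) cat" where
  "filtered_digraph_category = \<lparr>
     obj = {F. is_filtered_digraph F},
     hom = (\<lambda>F F'. {f. filtered_digraph_morphism F F' f}),
     ident = (\<lambda>F i. \<lambda>v\<in>pverts (dlevel F i). v),
     compos = (\<lambda>F F' F'' g f i. compose (pverts (dlevel F i)) (g i) (f i))\<rparr>"

section \<open>The adjacency digraph\<close>

definition Adj :: "'a stratified \<Rightarrow> 'a set pair_pre_digraph" where
  "Adj R = \<lparr>
     pverts = strata R,
     parcs = {(s, t). s \<in> strata R \<and> t \<in> strata R \<and>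
                (euclidean (variety R) closure_of s) \<inter> t \<noteq> {}}\<rparr>"

definition Adj_map :: "'a stratified \<Rightarrow> 'b stratified \<Rightarrow> ('a \<Rightarrow> 'b) \<Rightarrow> 'a set \<Rightarrow> 'b set" where
  "Adj_map R R' \<zeta> = (\<lambda>s\<in>strata R. THE t. t \<in> strata R' \<and> \<zeta> ` s \<subseteq> t)"

definition filtered_Adj :: "'a filtered_stratified \<Rightarrow> 'a set filtered_digraph" where
  "filtered_Adj F = \<lparr>
     dlevel = (\<lambda>i. Adj (level F i)),
     dincl = (\<lambda>i. Adj_map (level F i) (level F (Suc i)) (incl F i))\<rparr>"

definition filtered_Adj_map ::
  "'a filtered_stratified \<Rightarrow> 'b filtered_stratified \<Rightarrow> (nat \<Rightarrow> 'a \<Rightarrow> 'b) \<Rightarrow>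
   nat \<Rightarrow> 'a set \<Rightarrow> 'b set" where
  "filtered_Adj_map F F' \<zeta> = (\<lambda>i. Adj_map (level F i) (level F' i) (\<zeta> i))"

end

theory Submission
  imports Defs
begin

text \<open>The mathematical content is that a regular map between real varieties is continuous for the
  Euclidean topologies (\<open>regular_map_continuous_euclidean\<close>). Around each point, a regular function
  is read through an affine chart as a quotient of polynomials whose denominator does not vanish
  on a Zariski neighbourhood, hence it is continuous; and a map into an affine chart is
  continuous because its coordinates are regular functions. Given continuity, \<open>\<zeta>\<close> maps the closure
  of \<open>s\<close> into the closure of the image of \<open>s\<close>, so a point of \<open>t\<close> in the closure of \<open>s\<close> goes to a
  point of the stratum containing \<open>\<zeta> ` t\<close> in the closure of the stratum containing \<open>\<zeta> ` s\<close>. This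
  makes \<open>Adj_map\<close> a digraph morphism. Its compatibility with identities and composition holds
  since strata are non-empty and disjoint: any stratum containing the image of \<open>s\<close> is the image of
  the vertex \<open>s\<close>.

  Two strata with equal or disjoint images need not keep this property under a second morphism,
  so both source categories are generated by arrows that are not closed under composition.
  Functoriality is therefore shown on a larger category with the same objects, whose arrows are the
  Euclidean-continuous maps sending each stratum into a stratum (and commuting with the embeddings
  in the filtered case), and then restricted (\<open>is_functor_generated_category\<close>).

  In the filtered case, the maps \<open>Adj_map\<close> of the embeddings are injective on vertices because the
  stratum \<open>s\<close> is recovered from its image \<open>s'\<close> as the preimage of \<open>s'\<close>.\<close>

section \<open>Functors on generated categories\<close>

text \<open>The arrows generated by a family of hom-sets stay inside every category that contains the
  family and has the same objects, identities and composition. The equational laws are therefore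
  inherited from the larger category, while closure under composition holds by construction.\<close>

lemma is_functor_generated_category:
  assumes wide: "is_functor (\<C>\<lparr>hom := H\<rparr>) \<D> F F'"
    and sub: "\<And>A B. \<lbrakk>A \<in> obj \<C>; B \<in> obj \<C>\<rbrakk> \<Longrightarrow> hom \<C> A B \<subseteq> H A B"
  shows "is_functor (generated_category \<C>) \<D> F F'"
proof -
  have cat: "is_category (\<C>\<lparr>hom := H\<rparr>)"
    using wide by (simp add: is_functor_def)
  have inH: "f \<in> H A B" if "generated_arrow \<C> A B f" for A B f
    using that
  proof induction
    case (arrow A B f)
    then show ?case using sub by blast
  next
    case (ident A)
    then show ?case using cat by (simp add: is_category_def)
  next
    case (compos A B f C g)
    then have "A \<in> obj \<C>" "B \<in> obj \<C>" "C \<in> obj \<C>"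
      by (blast dest: generated_arrow_objD)+
    with compos cat show ?case by (simp add: is_category_def)
  qed
  have "is_category (generated_category \<C>)"
    unfolding is_category_def
  proof (intro conjI)
    show "\<forall>A\<in>obj (generated_category \<C>).
        ident (generated_category \<C>) A \<in> hom (generated_category \<C>) A A"
      by (simp add: generated_category_def generated_arrow.ident)
  next
    show "\<forall>A\<in>obj (generated_category \<C>). \<forall>B\<in>obj (generated_category \<C>).
        \<forall>C\<in>obj (generated_category \<C>). \<forall>f\<in>hom (generated_category \<C>) A B.
        \<forall>g\<in>hom (generated_category \<C>) B C.
        compos (generated_category \<C>) A B C g f \<in> hom (generated_category \<C>) A C"
      by (auto simp: generated_category_def intro: generated_arrow.compos)
  qed (use cat inH in \<open>simp_all add: generated_category_def is_category_def\<close>)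
  then show ?thesis
    using wide inH by (simp add: generated_category_def is_functor_def)
qed

section \<open>Euclidean continuity of regular maps\<close>

lemma topspace_affine_zariski [simp]: "topspace (affine_zariski n) = aff n"
proof -
  have "aff n - aff n = zero_set n {\<lambda>x. 1}"
    by (simp add: zero_set_def)
  then have "openin (affine_zariski n) (aff n)"
    unfolding openin_affine_zariski real_algebraic_set_def
    using polynomial_fun.const[of n 1] by (intro conjI exI[of _ "{\<lambda>x. 1}"]) auto
  then show ?thesis
    by (meson openin_affine_zariski openin_subset openin_topspace subset_antisym)
qed

lemma zariski_affine_space [simp]: "zariski (affine_space n) = affine_zariski n"
  by (simp add: affine_space_def)

lemma zariski_subfspace [simp]: "zariski (subfspace X A) = subtopology (zariski X) A"
  by (simp add: subfspace_def)

lemma continuous_map_coordinate_Euclidean_space: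
  "continuous_map (Euclidean_space n) euclideanreal (\<lambda>x. x i)"
  unfolding Euclidean_space_def
  by (intro continuous_map_from_subtopology continuous_map_product_projection) simp

lemma polynomial_fun_continuous:
  "polynomial_fun n p \<Longrightarrow> continuous_map (Euclidean_space n) euclideanreal p"
  by (induction rule: polynomial_fun.induct)
    (simp_all add: continuous_map_coordinate_Euclidean_space continuous_map_add
      continuous_map_real_mult)

lemma zariski_open_imp_Euclidean_open:
  assumes "openin (affine_zariski n) N"
  shows "openin (Euclidean_space n) N"
proof -
  obtain P where P: "P \<subseteq> Collect (polynomial_fun n)" and N: "N \<subseteq> aff n" "aff n - N = zero_set n P"
    using assms by (auto simp: openin_affine_zariski real_algebraic_set_def)
  have "{x \<in> aff n. p x \<in> - {0}} = {x \<in> aff n. p x \<noteq> 0}" for p by auto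
  then have "openin (Euclidean_space n) {x \<in> aff n. p x \<noteq> 0}" if "p \<in> P" for p
    using openin_continuous_map_preimage[of "Euclidean_space n" euclideanreal p "- {0}"]
      polynomial_fun_continuous P that by auto
  moreover have "N = (\<Union>p\<in>P. {x \<in> aff n. p x \<noteq> 0})"
    using N by (auto simp: zero_set_def)
  ultimately show ?thesis by auto
qed

lemma affine_chart_inverse:
  assumes "affine_chart X U n \<phi>"
  obtains V g where "openin (zariski X) U" "V \<subseteq> aff n"
    "regular_map (subfspace X U) (subfspace (affine_space n) V) \<phi>"
    "regular_map (subfspace (affine_space n) V) (subfspace X U) g"
    "\<And>x. x \<in> U \<Longrightarrow> \<phi> x \<in> V" "\<And>x. x \<in> U \<Longrightarrow> g (\<phi> x) = x"
proof -
  obtain V where V: "openin (zariski X) U" "real_algebraic_set n V"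
    "regular_iso (subfspace X U) (subfspace (affine_space n) V) \<phi>"
    using assms by (auto simp: affine_chart_def)
  have pV: "V \<subseteq> aff n"
    using V(2) by (auto simp: real_algebraic_set_def zero_set_def)
  have pU: "topspace (zariski X) \<inter> U = U"
    using openin_subset[OF V(1)] by auto
  obtain g where g: "regular_map (subfspace (affine_space n) V) (subfspace X U) g"
    "\<forall>x\<in>points (subfspace X U). g (\<phi> x) = x"
    using V(3) by (auto simp: regular_iso_def)
  have \<phi>: "regular_map (subfspace X U) (subfspace (affine_space n) V) \<phi>"
    using V(3) by (simp add: regular_iso_def)
  then have "\<phi> x \<in> V" if "x \<in> U" for x
    using that pU by (auto simp: regular_map_def PiE_iff)
  moreover have "g (\<phi> x) = x" if "x \<in> U" for x
    using that pU g(2) by simp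
  ultimately show thesis
    using that V(1) pV \<phi> g(1) by blast
qed

lemma openin_euclidean_chart:
  assumes "affine_chart X U n \<phi>" "openin (Euclidean_space n) T"
  shows "openin (euclidean X) {x \<in> U. \<phi> x \<in> T}"
  unfolding euclidean_def using assms by (intro topology_generated_by_Basis) blast

lemma affine_chart_at:
  assumes "real_variety X" "x \<in> points X"
  obtains U n \<phi> where "affine_chart X U n \<phi>" "x \<in> U"
  using assms unfolding real_variety_def by (metis UnionE)

lemma topspace_euclidean:
  assumes "real_variety X"
  shows "topspace (euclidean X) = points X"
proof
  show "topspace (euclidean X) \<subseteq> points X"
    unfolding euclidean_def by (auto simp: affine_chart_def dest: openin_subset)
next
  show "points X \<subseteq> topspace (euclidean X)"
  proof
    fix x assume "x \<in> points X"
    then obtain U n \<phi> where c: "affine_chart X U n \<phi>" and x: "x \<in> U"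
      using affine_chart_at assms by metis
    obtain V where "V \<subseteq> aff n" "\<And>x. x \<in> U \<Longrightarrow> \<phi> x \<in> V"
      by (rule affine_chart_inverse[OF c]) blast
    then have "x \<in> {x \<in> U. \<phi> x \<in> aff n}" using x by blast
    then show "x \<in> topspace (euclidean X)"
      using openin_subset[OF openin_euclidean_chart[OF c openin_topspace]] by blast
  qed
qed

text \<open>Transport along the inverse of the chart turns a regular function into a regular function on
  an algebraic set, and such a function is locally a restriction of a rational function on affine
  space.\<close>

lemma regular_function_in_chart:
  assumes c: "affine_chart X U n \<phi>" and W: "openin (zariski X) W" and h: "h \<in> regular X W"
    and x: "x \<in> U" "x \<in> W"
  obtains N p q where "openin (affine_zariski n) N" "\<phi> x \<in> N" "polynomial_fun n p"
    "polynomial_fun n q" "\<And>y. y \<in> N \<Longrightarrow> q y \<noteq> 0"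
    "\<And>z. \<lbrakk>z \<in> U; \<phi> z \<in> N\<rbrakk> \<Longrightarrow> z \<in> W \<and> h z = p (\<phi> z) / q (\<phi> z)"
proof -
  obtain V g where U: "openin (zariski X) U" and V: "V \<subseteq> aff n"
    and g: "regular_map (subfspace (affine_space n) V) (subfspace X U) g"
    and \<phi>V: "\<And>x. x \<in> U \<Longrightarrow> \<phi> x \<in> V" and g\<phi>: "\<And>x. x \<in> U \<Longrightarrow> g (\<phi> x) = x"
    by (rule affine_chart_inverse[OF c]) blast
  define S where "S = {v \<in> V. g v \<in> U \<inter> W}"
  define k where "k = compose S (restrict h (U \<inter> W)) g"
  have "restrict h (U \<inter> W) \<in> regular (subfspace X U) (U \<inter> W)"
    using W h by (auto simp: subfspace_def)
  moreover have "openin (zariski (subfspace X U)) (U \<inter> W)"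
    using W by (auto simp: openin_subtopology)
  ultimately have "compose {v \<in> points (subfspace (affine_space n) V). g v \<in> U \<inter> W}
      (restrict h (U \<inter> W)) g
    \<in> regular (subfspace (affine_space n) V)
        {v \<in> points (subfspace (affine_space n) V). g v \<in> U \<inter> W}"
    using g unfolding regular_map_def by blast
  moreover have "{v \<in> points (subfspace (affine_space n) V). g v \<in> U \<inter> W} = S"
    using V by (auto simp: S_def)
  ultimately have k: "k \<in> regular (subfspace (affine_space n) V) S"
    by (simp add: k_def)
  have \<phi>x: "\<phi> x \<in> S" using x \<phi>V g\<phi> by (simp add: S_def)
  obtain N1 l where N1: "openin (affine_zariski n) N1" "\<phi> x \<in> N1" "N1 \<inter> V \<subseteq> S"
    "l \<in> regular (affine_space n) N1" "\<And>y. y \<in> N1 \<inter> V \<Longrightarrow> k y = l y"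
    using k \<phi>x by (simp add: subfspace_def) blast
  obtain N p q where N: "openin (affine_zariski n) N" "\<phi> x \<in> N" "N \<subseteq> N1"
    "polynomial_fun n p" "polynomial_fun n q" "\<forall>y\<in>N. q y \<noteq> 0 \<and> l y = p y / q y"
    using N1(2,4) by (simp add: affine_space_def) blast
  have "z \<in> W \<and> h z = p (\<phi> z) / q (\<phi> z)" if z: "z \<in> U" "\<phi> z \<in> N" for z
  proof -
    have 1: "\<phi> z \<in> N1 \<inter> V" using z N(3) \<phi>V by blast
    then have 2: "\<phi> z \<in> S" using N1(3) by blast
    then have "z \<in> W" using g\<phi> z by (simp add: S_def)
    moreover have "h z = k (\<phi> z)"
      using 2 \<open>z \<in> W\<close> g\<phi> z by (simp add: k_def compose_def)
    ultimately show ?thesis using N1(5)[OF 1] N(6) z by simp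
  qed
  then show thesis using that N by blast
qed

text \<open>In a chart, a Zariski-open set is the trace of a Zariski-open set of affine space, by Zariski
  continuity of the inverse of the chart.\<close>

lemma zariski_open_imp_euclidean_open:
  assumes X: "real_variety X" and W: "openin (zariski X) W"
  shows "openin (euclidean X) W"
proof (subst openin_subopen, intro ballI)
  fix x assume x: "x \<in> W"
  then have "x \<in> points X" using openin_subset[OF W] by blast
  then obtain U n \<phi> where c: "affine_chart X U n \<phi>" and xU: "x \<in> U"
    using affine_chart_at X by metis
  obtain V g where U: "openin (zariski X) U" and V: "V \<subseteq> aff n"
    and g: "regular_map (subfspace (affine_space n) V) (subfspace X U) g"
    and \<phi>V: "\<And>x. x \<in> U \<Longrightarrow> \<phi> x \<in> V" and g\<phi>: "\<And>x. x \<in> U \<Longrightarrow> g (\<phi> x) = x"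
    by (rule affine_chart_inverse[OF c]) blast
  have "continuous_map (subtopology (affine_zariski n) V) (subtopology (zariski X) U) g"
    using g by (simp add: regular_map_def)
  moreover have "openin (subtopology (zariski X) U) (U \<inter> W)"
    using W by (auto simp: openin_subtopology)
  ultimately have "openin (subtopology (affine_zariski n) V)
      {v \<in> topspace (subtopology (affine_zariski n) V). g v \<in> U \<inter> W}"
    by (rule openin_continuous_map_preimage)
  then obtain N where N: "openin (affine_zariski n) N" "{v \<in> aff n \<inter> V. g v \<in> U \<inter> W} = N \<inter> V"
    by (auto simp: openin_subtopology)
  have "\<phi> z \<in> N \<longleftrightarrow> z \<in> W" if z: "z \<in> U" for z
  proof -
    have "\<phi> z \<in> aff n \<inter> V" using z V \<phi>V by blast
    then have "\<phi> z \<in> N \<longleftrightarrow> g (\<phi> z) \<in> U \<inter> W" using N(2) by blast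
    then show ?thesis using z g\<phi> by simp
  qed
  then have "{z \<in> U. \<phi> z \<in> N} = U \<inter> W" by blast
  then have "openin (euclidean X) (U \<inter> W)"
    using openin_euclidean_chart[OF c zariski_open_imp_Euclidean_open[OF N(1)]] by simp
  then show "\<exists>T. openin (euclidean X) T \<and> x \<in> T \<and> T \<subseteq> W"
    using x xU by blast
qed

lemma regular_function_continuous_euclidean:
  assumes X: "real_variety X" and W: "openin (zariski X) W" and h: "h \<in> regular X W"
  shows "continuous_map (subtopology (euclidean X) W) euclideanreal h"
proof -
  have WX: "W \<subseteq> points X" using openin_subset[OF W] .
  have oW: "openin (euclidean X) W" using zariski_open_imp_euclidean_open[OF X W] .
  have "openin (euclidean X) {x \<in> W. h x \<in> B}" if B: "open B" for B
  proof (subst openin_subopen, intro ballI)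
    fix x assume "x \<in> {x \<in> W. h x \<in> B}"
    then have x: "x \<in> W" "h x \<in> B" by auto
    then obtain U n \<phi> where c: "affine_chart X U n \<phi>" and xU: "x \<in> U"
      using affine_chart_at X WX by (metis subsetD)
    obtain N p q where N: "openin (affine_zariski n) N" "\<phi> x \<in> N" "polynomial_fun n p"
      "polynomial_fun n q" "\<And>y. y \<in> N \<Longrightarrow> q y \<noteq> 0"
      and hN: "\<And>z. \<lbrakk>z \<in> U; \<phi> z \<in> N\<rbrakk> \<Longrightarrow> z \<in> W \<and> h z = p (\<phi> z) / q (\<phi> z)"
      using regular_function_in_chart[OF c W h xU x(1)] by metis
    have oN: "openin (Euclidean_space n) N"
      using N(1) by (rule zariski_open_imp_Euclidean_open)
    have "continuous_map (subtopology (Euclidean_space n) N) euclideanreal (\<lambda>y. p y / q y)"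
      using N by (intro continuous_map_real_divide continuous_map_from_subtopology
          polynomial_fun_continuous) auto
    moreover have "topspace (subtopology (Euclidean_space n) N) = N"
      using openin_subset[OF oN] by auto
    ultimately have "openin (subtopology (Euclidean_space n) N) {y \<in> N. p y / q y \<in> B}"
      using openin_continuous_map_preimage[of "subtopology (Euclidean_space n) N" euclideanreal
          "\<lambda>y. p y / q y" B] B by simp
    then have oT: "openin (Euclidean_space n) {y \<in> N. p y / q y \<in> B}"
      using oN openin_trans_full by blast
    show "\<exists>T. openin (euclidean X) T \<and> x \<in> T \<and> T \<subseteq> {x \<in> W. h x \<in> B}"
    proof (intro exI conjI)
      show "openin (euclidean X) {z \<in> U. \<phi> z \<in> {y \<in> N. p y / q y \<in> B}}"
        using c oT by (rule openin_euclidean_chart)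
    qed (use N(2) xU x hN in auto)
  qed
  moreover have "topspace (subtopology (euclidean X) W) = W"
    using WX topspace_euclidean[OF X] by auto
  ultimately show ?thesis
    using oW by (auto simp: continuous_map_def openin_open_subtopology)
qed

text \<open>The functions of an open subspace only extend locally to the ambient space; the gluing axiom
  makes them sections of the ambient sheaf.\<close>

lemma regular_subfspace_open:
  assumes X: "sheaf_of_functions X" and U: "openin (zariski X) U" and W: "openin (zariski X) W"
    and WU: "W \<subseteq> U" and f: "f \<in> regular (subfspace X U) W"
  shows "f \<in> regular X W"
proof -
  have fe: "f \<in> extensional W" using f by (simp add: subfspace_def)
  have "\<exists>V. openin (zariski X) V \<and> x \<in> V \<and> V \<subseteq> W \<and> restrict f V \<in> regular X V"
    if x: "x \<in> W" for x
  proof -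
    obtain N g where N: "openin (zariski X) N" "x \<in> N" "N \<inter> U \<subseteq> W" "g \<in> regular X N"
      "\<forall>y\<in>N \<inter> U. f y = g y"
      using f x by (simp add: subfspace_def) blast
    have o: "openin (zariski X) (N \<inter> U)" using N(1) U by blast
    have "restrict g (N \<inter> U) \<in> regular X (N \<inter> U)"
      using X o N(1,4) unfolding sheaf_of_functions_def by (meson Int_lower1)
    moreover have "restrict f (N \<inter> U) = restrict g (N \<inter> U)"
      using N(5) by (auto intro: restrict_ext)
    ultimately show ?thesis using o N x WU by (intro exI[of _ "N \<inter> U"]) auto
  qed
  then show ?thesis
    using W fe
    by (intro X[unfolded sheaf_of_functions_def, THEN conjunct2, THEN conjunct2, THEN spec,
        THEN bspec, THEN mp] conjI ballI)
qed

lemma chart_coordinate_regular: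
  assumes X: "sheaf_of_functions X" and c: "affine_chart X U n \<phi>" and i: "i < n"
  shows "(\<lambda>x\<in>U. \<phi> x i) \<in> regular X U"
proof -
  obtain V g where U: "openin (zariski X) U" and V: "V \<subseteq> aff n"
    and \<phi>: "regular_map (subfspace X U) (subfspace (affine_space n) V) \<phi>"
    and \<phi>V: "\<And>x. x \<in> U \<Longrightarrow> \<phi> x \<in> V"
    by (rule affine_chart_inverse[OF c]) blast
  have oa: "openin (affine_zariski n) (aff n)"
    using openin_topspace[of "affine_zariski n"] by simp
  have a: "(\<lambda>y\<in>aff n. y i) \<in> regular (affine_space n) (aff n)"
  proof -
    have "\<exists>N p q. openin (affine_zariski n) N \<and> x \<in> N \<and> N \<subseteq> aff n \<and> polynomial_fun n p \<and>
        polynomial_fun n q \<and> (\<forall>y\<in>N. q y \<noteq> 0 \<and> (\<lambda>y\<in>aff n. y i) y = p y / q y)"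
      if "x \<in> aff n" for x
      using that oa polynomial_fun.coord[OF i] polynomial_fun.const[of n 1]
      by (intro exI[of _ "aff n"] exI[of _ "\<lambda>y. y i"] exI[of _ "\<lambda>y. 1"]) simp
    then show ?thesis by (simp add: affine_space_def)
  qed
  have "(\<lambda>v\<in>V. v i) \<in> regular (subfspace (affine_space n) V) V"
  proof -
    have "\<exists>N g. openin (affine_zariski n) N \<and> x \<in> N \<and> N \<inter> V \<subseteq> V \<and>
        g \<in> regular (affine_space n) N \<and> (\<forall>y\<in>N \<inter> V. (\<lambda>v\<in>V. v i) y = g y)" if "x \<in> V" for x
      using that V oa a by (intro exI[of _ "aff n"] exI[of _ "\<lambda>y\<in>aff n. y i"]) auto
    then show ?thesis by (simp add: subfspace_def)
  qed
  moreover have "openin (zariski (subfspace (affine_space n) V)) V"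
    using V oa by (auto simp: openin_subtopology)
  ultimately have "compose {x \<in> points (subfspace X U). \<phi> x \<in> V} (\<lambda>v\<in>V. v i) \<phi>
      \<in> regular (subfspace X U) {x \<in> points (subfspace X U). \<phi> x \<in> V}"
    using \<phi> unfolding regular_map_def by blast
  moreover have "{x \<in> points (subfspace X U). \<phi> x \<in> V} = U"
    using openin_subset[OF U] \<phi>V by auto
  moreover have "compose U (\<lambda>v\<in>V. v i) \<phi> = (\<lambda>x\<in>U. \<phi> x i)"
    using \<phi>V by (auto simp: compose_def intro: restrict_ext)
  ultimately have "(\<lambda>x\<in>U. \<phi> x i) \<in> regular (subfspace X U) U" by simp
  then show ?thesis using regular_subfspace_open[OF X U U] by simp
qed

theorem regular_map_continuous_euclidean:
  assumes X: "real_variety X" and Y: "real_variety Y" and f: "regular_map X Y f"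
  shows "continuous_map (euclidean X) (euclidean Y) f"
proof -
  have fY: "f ` points X \<subseteq> points Y" using f by (auto simp: regular_map_def)
  have preimage: "openin (euclidean X) {x \<in> points X. f x \<in> {y \<in> U. \<phi> y \<in> T}}"
    if c: "affine_chart Y U n \<phi>" and T: "openin (Euclidean_space n) T" for U n \<phi> T
  proof -
    define W where "W = {x \<in> points X. f x \<in> U}"
    obtain V where U: "openin (zariski Y) U" and V: "V \<subseteq> aff n" and \<phi>V: "\<And>x. x \<in> U \<Longrightarrow> \<phi> x \<in> V"
      by (rule affine_chart_inverse[OF c]) blast
    have W: "openin (zariski X) W"
      using f U unfolding regular_map_def W_def by (blast intro: openin_continuous_map_preimage)
    have tW: "topspace (subtopology (euclidean X) W) = W"
      using topspace_euclidean[OF X] by (auto simp: W_def)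
    \<comment> \<open>A coordinate of the chart is a regular function, so its pullback along \<open>f\<close> is regular.\<close>
    have "continuous_map (subtopology (euclidean X) W) euclideanreal (\<lambda>x. \<phi> (f x) i)"
      if i: "i < n" for i
    proof -
      have "(\<lambda>y\<in>U. \<phi> y i) \<in> regular Y U"
        using Y chart_coordinate_regular[OF _ c i] by (simp add: real_variety_def)
      then have "compose W (\<lambda>y\<in>U. \<phi> y i) f \<in> regular X W"
        using f U unfolding regular_map_def W_def by blast
      then have "continuous_map (subtopology (euclidean X) W) euclideanreal
          (compose W (\<lambda>y\<in>U. \<phi> y i) f)"
        by (rule regular_function_continuous_euclidean[OF X W])
      then show ?thesis
        by (rule continuous_map_eq) (auto simp: tW compose_def W_def)
    qed
    then have "continuous_map (subtopology (euclidean X) W) (Euclidean_space n)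
        (\<lambda>x i. if i < n then \<phi> (f x) i else 0)"
      by (simp add: continuous_map_componentwise_Euclidean_space)
    moreover have "(\<lambda>i. if i < n then \<phi> (f x) i else 0) = \<phi> (f x)" if "x \<in> W" for x
    proof -
      have "\<phi> (f x) \<in> aff n" using that \<phi>V V by (auto simp: W_def)
      then show ?thesis by (auto simp: topspace_Euclidean_space)
    qed
    ultimately have "continuous_map (subtopology (euclidean X) W) (Euclidean_space n)
        (\<lambda>x. \<phi> (f x))"
      by (auto intro: continuous_map_eq simp: tW)
    then have "openin (subtopology (euclidean X) W) {x \<in> W. \<phi> (f x) \<in> T}"
      using openin_continuous_map_preimage T tW by fastforce
    then have "openin (euclidean X) {x \<in> W. \<phi> (f x) \<in> T}"
      using openin_trans_full zariski_open_imp_euclidean_open[OF X W] by blast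
    moreover have "{x \<in> W. \<phi> (f x) \<in> T} = {x \<in> points X. f x \<in> {y \<in> U. \<phi> y \<in> T}}"
      by (auto simp: W_def)
    ultimately show ?thesis by simp
  qed
  show ?thesis
    unfolding euclidean_def[of Y]
  proof (rule continuous_on_generated_topo)
    fix S
    assume "S \<in> {{y \<in> U. \<phi> y \<in> T} | U n \<phi> T.
        affine_chart Y U n \<phi> \<and> openin (Euclidean_space n) T}"
    then obtain U n \<phi> T where S: "S = {y \<in> U. \<phi> y \<in> T}"
      and cT: "affine_chart Y U n \<phi>" "openin (Euclidean_space n) T"
      by blast
    have "f -` S \<inter> topspace (euclidean X) = {x \<in> points X. f x \<in> S}"
      using topspace_euclidean[OF X] by auto
    then show "openin (euclidean X) (f -` S \<inter> topspace (euclidean X))"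
      using preimage[OF cT] S by simp
  next
    show "f ` topspace (euclidean X) \<subseteq> \<Union> {{y \<in> U. \<phi> y \<in> T} | U n \<phi> T.
        affine_chart Y U n \<phi> \<and> openin (Euclidean_space n) T}"
      using fY topspace_euclidean[OF X] topspace_euclidean[OF Y]
      unfolding euclidean_def[of Y] topology_generated_by_topspace by simp
  qed
qed

section \<open>The action of continuous stratum-preserving maps on strata\<close>

text \<open>Unlike stratified morphisms, these maps are closed under composition.\<close>

definition continuous_stratum_map :: "'a stratified \<Rightarrow> 'b stratified \<Rightarrow> ('a \<Rightarrow> 'b) \<Rightarrow> bool" where
  "continuous_stratum_map R R' \<zeta> \<longleftrightarrow> \<zeta> \<in> pts R \<rightarrow>\<^sub>E pts R' \<and>
     continuous_map (euclidean (variety R)) (euclidean (variety R')) \<zeta> \<and>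
     (\<forall>s\<in>strata R. \<exists>s'\<in>strata R'. \<zeta> ` s \<subseteq> s')"

lemma regular_imp_continuous_stratum_map:
  assumes "stratified_variety R" "stratified_variety R'"
    and "regular_map (variety R) (variety R') \<zeta>" "\<forall>s\<in>strata R. \<exists>s'\<in>strata R'. \<zeta> ` s \<subseteq> s'"
  shows "continuous_stratum_map R R' \<zeta>"
  using assms regular_map_continuous_euclidean[of "variety R" "variety R'" \<zeta>]
  by (auto simp: continuous_stratum_map_def stratified_variety_def regular_map_def)

lemma stratified_morphism_imp_continuous_stratum_map:
  assumes "stratified_variety R" "stratified_variety R'" "stratified_morphism R R' \<zeta>"
  shows "continuous_stratum_map R R' \<zeta>"
  using assms by (auto simp: stratified_morphism_def intro: regular_imp_continuous_stratum_map)

lemma stratum_subset_pts: "\<lbrakk>stratified_variety R; s \<in> strata R\<rbrakk> \<Longrightarrow> s \<subseteq> pts R"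
  by (auto simp: stratified_variety_def partition_on_def)

lemma stratum_nonempty: "\<lbrakk>stratified_variety R; s \<in> strata R\<rbrakk> \<Longrightarrow> s \<noteq> {}"
  by (auto simp: stratified_variety_def partition_on_def)

lemma strata_eqI:
  "\<lbrakk>stratified_variety R; s \<in> strata R; t \<in> strata R; x \<in> s; x \<in> t\<rbrakk> \<Longrightarrow> s = t"
  unfolding stratified_variety_def partition_on_def disjoint_def by blast

lemma continuous_stratum_map_ident:
  assumes "stratified_variety R"
  shows "continuous_stratum_map R R (\<lambda>x\<in>pts R. x)"
proof -
  have t: "topspace (euclidean (variety R)) = pts R"
    using assms topspace_euclidean by (auto simp: stratified_variety_def)
  have "continuous_map (euclidean (variety R)) (euclidean (variety R)) (\<lambda>x\<in>pts R. x)"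
    by (rule continuous_map_eq[OF continuous_map_id]) (simp add: t)
  moreover have "(\<lambda>x\<in>pts R. x) ` s \<subseteq> s" if "s \<in> strata R" for s
    using stratum_subset_pts[OF assms that] by auto
  ultimately show ?thesis
    by (auto simp: continuous_stratum_map_def)
qed

lemma continuous_stratum_map_compose:
  assumes R: "stratified_variety R"
    and \<zeta>: "continuous_stratum_map R R' \<zeta>" and \<xi>: "continuous_stratum_map R' R'' \<xi>"
  shows "continuous_stratum_map R R'' (compose (pts R) \<xi> \<zeta>)"
proof -
  have t: "topspace (euclidean (variety R)) = pts R"
    using R topspace_euclidean by (auto simp: stratified_variety_def)
  have "continuous_map (euclidean (variety R)) (euclidean (variety R'')) (\<xi> \<circ> \<zeta>)"
    using \<zeta> \<xi> unfolding continuous_stratum_map_def by (elim conjE) (rule continuous_map_compose)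
  then have "continuous_map (euclidean (variety R)) (euclidean (variety R''))
      (compose (pts R) \<xi> \<zeta>)"
    by (rule continuous_map_eq) (simp add: t compose_def)
  moreover have "compose (pts R) \<xi> \<zeta> \<in> pts R \<rightarrow>\<^sub>E pts R''"
    using \<zeta> \<xi> by (auto simp: continuous_stratum_map_def compose_def PiE_iff)
  moreover have "\<exists>s''\<in>strata R''. compose (pts R) \<xi> \<zeta> ` s \<subseteq> s''" if s: "s \<in> strata R" for s
  proof -
    obtain s' where "s' \<in> strata R'" "\<zeta> ` s \<subseteq> s'"
      using \<zeta> s by (auto simp: continuous_stratum_map_def)
    moreover then obtain s'' where "s'' \<in> strata R''" "\<xi> ` s' \<subseteq> s''"
      using \<xi> by (auto simp: continuous_stratum_map_def)
    moreover have "s \<subseteq> pts R" using R s by (rule stratum_subset_pts)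
    ultimately show ?thesis
      by (intro bexI[of _ s'']) (auto simp: compose_def)
  qed
  ultimately show ?thesis by (simp add: continuous_stratum_map_def)
qed

text \<open>Strata being disjoint, one point of a stratum already determines where \<open>Adj_map\<close> sends it.\<close>

lemma Adj_map_eqI:
  assumes "stratified_variety R'" "continuous_stratum_map R R' \<zeta>"
    and "s \<in> strata R" "t \<in> strata R'" "x \<in> s" "\<zeta> x \<in> t"
  shows "Adj_map R R' \<zeta> s = t"
proof -
  have unique: "s' = t" if "s' \<in> strata R'" "\<zeta> ` s \<subseteq> s'" for s'
    using strata_eqI[OF assms(1) that(1) assms(4) _ assms(6)] that(2) assms(5) by auto
  obtain s' where s': "s' \<in> strata R'" "\<zeta> ` s \<subseteq> s'"
    using assms(2,3) by (auto simp: continuous_stratum_map_def)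
  then have "\<zeta> ` s \<subseteq> t" using unique by blast
  then have "(THE t. t \<in> strata R' \<and> \<zeta> ` s \<subseteq> t) = t"
    by (intro the_equality conjI assms(4)) (simp_all add: unique)
  then show ?thesis using assms(3) by (simp add: Adj_map_def)
qed

lemma Adj_map_contains_image:
  assumes R: "stratified_variety R" "stratified_variety R'"
    and \<zeta>: "continuous_stratum_map R R' \<zeta>" and s: "s \<in> strata R"
  shows "Adj_map R R' \<zeta> s \<in> strata R'" "\<zeta> ` s \<subseteq> Adj_map R R' \<zeta> s"
proof -
  obtain s' where s': "s' \<in> strata R'" "\<zeta> ` s \<subseteq> s'"
    using \<zeta> s by (auto simp: continuous_stratum_map_def)
  obtain x where "x \<in> s" using stratum_nonempty[OF R(1) s] by blast
  then have "Adj_map R R' \<zeta> s = s'"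
    using s' R(2) \<zeta> s by (intro Adj_map_eqI[of R' R \<zeta> s s' x]) auto
  with s' show "Adj_map R R' \<zeta> s \<in> strata R'" "\<zeta> ` s \<subseteq> Adj_map R R' \<zeta> s" by auto
qed

lemma Adj_map_digraph_morphism:
  assumes R: "stratified_variety R" "stratified_variety R'" and \<zeta>: "continuous_stratum_map R R' \<zeta>"
  shows "digraph_morphism (Adj R) (Adj R') (Adj_map R R' \<zeta>)"
proof -
  have "euclidean (variety R') closure_of Adj_map R R' \<zeta> s \<inter> Adj_map R R' \<zeta> t \<noteq> {}"
    if s: "s \<in> strata R" and t: "t \<in> strata R"
      and e: "euclidean (variety R) closure_of s \<inter> t \<noteq> {}" for s t
  proof -
    obtain x where x: "x \<in> euclidean (variety R) closure_of s" "x \<in> t" using e by blast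
    have "\<zeta> x \<in> euclidean (variety R') closure_of (\<zeta> ` s)"
      using \<zeta> x(1) continuous_map_image_closure_subset[of _ _ \<zeta> s]
      by (auto simp: continuous_stratum_map_def)
    then have "\<zeta> x \<in> euclidean (variety R') closure_of Adj_map R R' \<zeta> s"
      using closure_of_mono[OF Adj_map_contains_image(2)[OF R \<zeta> s]] by blast
    then show ?thesis using Adj_map_contains_image(2)[OF R \<zeta> t] x(2) by blast
  qed
  moreover have "Adj_map R R' \<zeta> \<in> strata R \<rightarrow>\<^sub>E strata R'"
    using Adj_map_contains_image(1)[OF R \<zeta>] by (auto simp: Adj_map_def)
  ultimately show ?thesis
    using Adj_map_contains_image(1)[OF R \<zeta>] by (auto simp: digraph_morphism_def Adj_def)
qed

lemma Adj_map_ident: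
  assumes R: "stratified_variety R"
  shows "Adj_map R R (\<lambda>x\<in>pts R. x) = (\<lambda>s\<in>strata R. s)"
proof
  fix s
  show "Adj_map R R (\<lambda>x\<in>pts R. x) s = (\<lambda>s\<in>strata R. s) s"
  proof (cases "s \<in> strata R")
    case s: True
    obtain x where x: "x \<in> s" using stratum_nonempty[OF R s] by blast
    then have "x \<in> pts R" using stratum_subset_pts[OF R s] by blast
    then show ?thesis
      using Adj_map_eqI[OF R continuous_stratum_map_ident[OF R] s s x] x s by simp
  qed (simp add: Adj_map_def)
qed

lemma Adj_map_compose:
  assumes R: "stratified_variety R" "stratified_variety R'" "stratified_variety R''"
    and \<zeta>: "continuous_stratum_map R R' \<zeta>" and \<xi>: "continuous_stratum_map R' R'' \<xi>"
  shows "Adj_map R R'' (compose (pts R) \<xi> \<zeta>) =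
    compose (strata R) (Adj_map R' R'' \<xi>) (Adj_map R R' \<zeta>)"
proof
  fix s
  show "Adj_map R R'' (compose (pts R) \<xi> \<zeta>) s =
    compose (strata R) (Adj_map R' R'' \<xi>) (Adj_map R R' \<zeta>) s"
  proof (cases "s \<in> strata R")
    case s: True
    obtain x where x: "x \<in> s" using stratum_nonempty[OF R(1) s] by blast
    note s' = Adj_map_contains_image[OF R(1,2) \<zeta> s]
    note s'' = Adj_map_contains_image[OF R(2,3) \<xi> s'(1)]
    have "compose (pts R) \<xi> \<zeta> x = \<xi> (\<zeta> x)"
      using stratum_subset_pts[OF R(1) s] x by (auto simp: compose_def)
    then have "compose (pts R) \<xi> \<zeta> x \<in> Adj_map R' R'' \<xi> (Adj_map R R' \<zeta> s)"
      using s'(2) s''(2) x by auto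
    then have "Adj_map R R'' (compose (pts R) \<xi> \<zeta>) s = Adj_map R' R'' \<xi> (Adj_map R R' \<zeta> s)"
      using Adj_map_eqI[OF R(3) continuous_stratum_map_compose[OF R(1) \<zeta> \<xi>] s s''(1) x] by blast
    then show ?thesis using s by (simp add: compose_def)
  qed (simp add: Adj_map_def compose_def)
qed

section \<open>Functoriality for stratified varieties\<close>

lemma pair_wf_digraph_Adj: "pair_wf_digraph (Adj R)"
  by unfold_locales (auto simp: Adj_def)

lemma pverts_Adj [simp]: "pverts (Adj R) = strata R"
  by (simp add: Adj_def)

lemma digraph_morphism_ident: "pair_wf_digraph G \<Longrightarrow> digraph_morphism G G (\<lambda>v\<in>pverts G. v)"
  by (auto simp: digraph_morphism_def pair_wf_digraph_def)

lemma digraph_morphism_compose: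
  assumes "pair_wf_digraph G" "digraph_morphism G H f" "digraph_morphism H K g"
  shows "digraph_morphism G K (compose (pverts G) g f)"
  using assms
  by (fastforce simp: digraph_morphism_def pair_wf_digraph_def compose_def PiE_iff)

lemma is_category_digraph_category: "is_category digraph_category"
  unfolding is_category_def digraph_category_def
  by (auto simp: digraph_morphism_ident digraph_morphism_compose)
    (auto simp: digraph_morphism_def PiE_def intro!: compose_Id Id_compose compose_assoc)

definition continuous_stratum_category :: "('a stratified, 'a \<Rightarrow> 'a) cat" where
  "continuous_stratum_category =
     stratified_arrows\<lparr>hom := \<lambda>R R'. {\<zeta>. continuous_stratum_map R R' \<zeta>}\<rparr>"

lemma is_category_continuous_stratum_category: "is_category continuous_stratum_category"
  unfolding is_category_def continuous_stratum_category_def stratified_arrows_def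
  by (auto simp: continuous_stratum_map_ident continuous_stratum_map_compose)
    (auto simp: continuous_stratum_map_def PiE_def intro!: compose_Id Id_compose compose_assoc)

lemma is_functor_Adj_continuous:
  "is_functor continuous_stratum_category digraph_category Adj Adj_map"
  unfolding is_functor_def
  using is_category_continuous_stratum_category is_category_digraph_category
  by (auto simp: continuous_stratum_category_def stratified_arrows_def digraph_category_def
      pair_wf_digraph_Adj Adj_map_digraph_morphism Adj_map_ident Adj_map_compose)

theorem is_functor_Adj: "is_functor stratified_category digraph_category Adj Adj_map"
  unfolding stratified_category_def
proof (rule is_functor_generated_category)
  show "is_functor (stratified_arrows\<lparr>hom := \<lambda>R R'. {\<zeta>. continuous_stratum_map R R' \<zeta>}\<rparr>)
      digraph_category Adj Adj_map"
    using is_functor_Adj_continuous by (simp add: continuous_stratum_category_def)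
qed (auto simp: stratified_arrows_def intro: stratified_morphism_imp_continuous_stratum_map)

section \<open>Functoriality for filtered stratified varieties\<close>

lemma filtered_stratum_trace:
  "\<lbrakk>filtered_stratified_variety F; s \<in> strata (level F i)\<rbrakk> \<Longrightarrow>
    \<exists>s'\<in>strata (level F (Suc i)).
      incl F i ` s \<subseteq> s' \<and> s' \<inter> incl F i ` pts (level F i) = incl F i ` s"
  by (simp add: filtered_stratified_variety_def)

lemma filtered_level: "filtered_stratified_variety F \<Longrightarrow> stratified_variety (level F i)"
  by (simp add: filtered_stratified_variety_def)

lemma filtered_closed_embedding:
  "filtered_stratified_variety F \<Longrightarrow>
    closed_embedding (variety (level F i)) (variety (level F (Suc i))) (incl F i)"
  by (simp add: filtered_stratified_variety_def)

lemma filtered_incl_continuous_stratum_map: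
  assumes "filtered_stratified_variety F"
  shows "continuous_stratum_map (level F i) (level F (Suc i)) (incl F i)"
proof (rule regular_imp_continuous_stratum_map[OF filtered_level filtered_level, OF assms assms])
  show "regular_map (variety (level F i)) (variety (level F (Suc i))) (incl F i)"
    using filtered_closed_embedding[OF assms] by (simp add: closed_embedding_def)
  show "\<forall>s\<in>strata (level F i). \<exists>s'\<in>strata (level F (Suc i)). incl F i ` s \<subseteq> s'"
    using filtered_stratum_trace[OF assms] by (intro ballI) (metis (no_types, lifting))
qed

text \<open>A stratum \<open>s'\<close> of the next level meets the embedded variety in a single embedded stratum, so
  two strata sent to \<open>s'\<close> have equal images and coincide by injectivity of the embedding.\<close>

lemma Adj_map_incl_inj:
  assumes F: "filtered_stratified_variety F"
  shows "inj_on (Adj_map (level F i) (level F (Suc i)) (incl F i)) (strata (level F i))"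
proof -
  let ?R = "level F i" and ?R' = "level F (Suc i)" and ?l = "incl F i"
  let ?a = "Adj_map ?R ?R' ?l"
  note R = filtered_level[OF F, of i] and R' = filtered_level[OF F, of "Suc i"]
    and l = filtered_incl_continuous_stratum_map[OF F, of i]
  have "regular_iso (variety ?R) (subfspace (variety ?R') (?l ` pts ?R)) ?l"
    using filtered_closed_embedding[OF F] by (simp add: closed_embedding_def)
  then obtain g where "\<forall>x\<in>pts ?R. g (?l x) = x" by (auto simp: regular_iso_def)
  then have inj: "inj_on ?l (pts ?R)" by (intro inj_on_inverseI[of _ g]) simp
  have trace: "?a s \<inter> ?l ` pts ?R = ?l ` s" if s: "s \<in> strata ?R" for s
  proof -
    obtain s' where s': "s' \<in> strata ?R'" "?l ` s \<subseteq> s'" "s' \<inter> ?l ` pts ?R = ?l ` s"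
      using filtered_stratum_trace[OF F s] by blast
    obtain x where "x \<in> s" using stratum_nonempty[OF R s] by blast
    then have "?a s = s'" using Adj_map_eqI[OF R' l s s'(1)] s'(2) by blast
    with s'(3) show ?thesis by simp
  qed
  show ?thesis
  proof (rule inj_onI)
    fix s t assume st: "s \<in> strata ?R" "t \<in> strata ?R" "?a s = ?a t"
    then have "?l ` s = ?l ` t" using trace by metis
    then show "s = t"
      using inj_on_image_eq_iff[OF inj stratum_subset_pts[OF R st(1)] stratum_subset_pts[OF R st(2)]]
      by simp
  qed
qed

lemma is_filtered_digraph_filtered_Adj:
  "filtered_stratified_variety F \<Longrightarrow> is_filtered_digraph (filtered_Adj F)"
  by (simp add: is_filtered_digraph_def filtered_Adj_def pair_wf_digraph_Adj Adj_map_incl_inj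
      Adj_map_digraph_morphism filtered_level filtered_incl_continuous_stratum_map)

definition continuous_filtered_map ::
  "'a filtered_stratified \<Rightarrow> 'b filtered_stratified \<Rightarrow> (nat \<Rightarrow> 'a \<Rightarrow> 'b) \<Rightarrow> bool" where
  "continuous_filtered_map F F' \<zeta> \<longleftrightarrow> (\<forall>i.
     continuous_stratum_map (level F i) (level F' i) (\<zeta> i) \<and>
     (\<forall>x\<in>pts (level F i). \<zeta> (Suc i) (incl F i x) = incl F' i (\<zeta> i x)))"

lemma incl_in_pts:
  "\<lbrakk>filtered_stratified_variety F; x \<in> pts (level F i)\<rbrakk> \<Longrightarrow> incl F i x \<in> pts (level F (Suc i))"
  using filtered_incl_continuous_stratum_map[of F i]
  by (auto simp: continuous_stratum_map_def PiE_iff)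

lemma continuous_filtered_map_ident:
  assumes "filtered_stratified_variety F"
  shows "continuous_filtered_map F F (\<lambda>i. \<lambda>x\<in>pts (level F i). x)"
  using assms incl_in_pts[OF assms]
  by (simp add: continuous_filtered_map_def continuous_stratum_map_ident filtered_level)

lemma continuous_filtered_map_compose:
  assumes F: "filtered_stratified_variety F"
    and \<zeta>: "continuous_filtered_map F F' \<zeta>" and \<xi>: "continuous_filtered_map F' F'' \<xi>"
  shows "continuous_filtered_map F F'' (\<lambda>i. compose (pts (level F i)) (\<xi> i) (\<zeta> i))"
proof -
  have "\<zeta> i x \<in> pts (level F' i)" if "x \<in> pts (level F i)" for i x
    using \<zeta> that by (auto simp: continuous_filtered_map_def continuous_stratum_map_def PiE_iff)
  moreover have "continuous_stratum_map (level F i) (level F'' i)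
      (compose (pts (level F i)) (\<xi> i) (\<zeta> i))" for i
    using \<zeta> \<xi>
    by (intro continuous_stratum_map_compose[of _ "level F' i"] filtered_level[OF F])
      (simp_all add: continuous_filtered_map_def)
  ultimately show ?thesis
    using \<zeta> \<xi> incl_in_pts[OF F] by (simp add: continuous_filtered_map_def compose_eq)
qed

text \<open>Both composites of the square send \<open>s\<close> to the stratum containing the common image of a
  point of \<open>s\<close>.\<close>

lemma filtered_Adj_map_morphism:
  assumes F: "filtered_stratified_variety F" and F': "filtered_stratified_variety F'"
    and \<zeta>: "continuous_filtered_map F F' \<zeta>"
  shows "filtered_digraph_morphism (filtered_Adj F) (filtered_Adj F') (filtered_Adj_map F F' \<zeta>)"
proof -
  have \<zeta>i: "continuous_stratum_map (level F i) (level F' i) (\<zeta> i)" for i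
    using \<zeta> by (simp add: continuous_filtered_map_def)
  note R = filtered_level[OF F] and R' = filtered_level[OF F']
    and l = filtered_incl_continuous_stratum_map[OF F]
    and l' = filtered_incl_continuous_stratum_map[OF F']
  have "Adj_map (level F (Suc i)) (level F' (Suc i)) (\<zeta> (Suc i))
        (Adj_map (level F i) (level F (Suc i)) (incl F i) s) =
      Adj_map (level F' i) (level F' (Suc i)) (incl F' i)
        (Adj_map (level F i) (level F' i) (\<zeta> i) s)" (is "_ = ?t")
    if s: "s \<in> strata (level F i)" for i s
  proof -
    obtain x where x: "x \<in> s" using stratum_nonempty[OF R s] by blast
    note down = Adj_map_contains_image[OF R R' \<zeta>i s]
    note down_right = Adj_map_contains_image[OF R' R' l' down(1)]
    note right = Adj_map_contains_image[OF R R l s]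
    have "\<zeta> (Suc i) (incl F i x) = incl F' i (\<zeta> i x)"
      using \<zeta> x stratum_subset_pts[OF R s] by (auto simp: continuous_filtered_map_def)
    also have "\<dots> \<in> ?t" using down(2) down_right(2) x by blast
    finally show ?thesis
      using Adj_map_eqI[OF R' \<zeta>i right(1) down_right(1)] right(2) x by blast
  qed
  then show ?thesis
    using Adj_map_digraph_morphism[OF R R' \<zeta>i]
    by (simp add: filtered_digraph_morphism_def filtered_Adj_def filtered_Adj_map_def)
qed

lemma filtered_Adj_map_compose:
  assumes F: "filtered_stratified_variety F" "filtered_stratified_variety F'"
      "filtered_stratified_variety F''"
    and \<zeta>: "continuous_filtered_map F F' \<zeta>" and \<xi>: "continuous_filtered_map F' F'' \<xi>"
  shows "filtered_Adj_map F F'' (\<lambda>i. compose (pts (level F i)) (\<xi> i) (\<zeta> i)) =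
    (\<lambda>i. compose (strata (level F i)) (filtered_Adj_map F' F'' \<xi> i) (filtered_Adj_map F F' \<zeta> i))"
proof
  fix i
  have "continuous_stratum_map (level F i) (level F' i) (\<zeta> i)"
    and "continuous_stratum_map (level F' i) (level F'' i) (\<xi> i)"
    using \<zeta> \<xi> by (simp_all add: continuous_filtered_map_def)
  then show "filtered_Adj_map F F'' (\<lambda>i. compose (pts (level F i)) (\<xi> i) (\<zeta> i)) i =
      compose (strata (level F i)) (filtered_Adj_map F' F'' \<xi> i) (filtered_Adj_map F F' \<zeta> i)"
    unfolding filtered_Adj_map_def by (intro Adj_map_compose filtered_level F)
qed

lemma filtered_digraph_morphism_ident:
  assumes "is_filtered_digraph F"
  shows "filtered_digraph_morphism F F (\<lambda>i. \<lambda>v\<in>pverts (dlevel F i). v)"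
  using assms
  by (auto simp: filtered_digraph_morphism_def is_filtered_digraph_def digraph_morphism_ident)
    (auto simp: digraph_morphism_def PiE_iff)

lemma filtered_digraph_morphism_compose:
  assumes F: "is_filtered_digraph F"
    and f: "filtered_digraph_morphism F F' f" and g: "filtered_digraph_morphism F' F'' g"
  shows "filtered_digraph_morphism F F'' (\<lambda>i. compose (pverts (dlevel F i)) (g i) (f i))"
proof -
  have "f i v \<in> pverts (dlevel F' i)" "dincl F i v \<in> pverts (dlevel F (Suc i))"
    if "v \<in> pverts (dlevel F i)" for i v
    using F f that
    by (auto simp: filtered_digraph_morphism_def is_filtered_digraph_def digraph_morphism_def PiE_iff)
  moreover have "digraph_morphism (dlevel F i) (dlevel F'' i)
      (compose (pverts (dlevel F i)) (g i) (f i))" for i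
    using assms
    by (intro digraph_morphism_compose[of _ "dlevel F' i"])
      (simp_all add: filtered_digraph_morphism_def is_filtered_digraph_def)
  ultimately show ?thesis
    using f g by (simp add: filtered_digraph_morphism_def compose_eq)
qed

lemma levelwise_compose_Id:
  assumes "\<And>i. f i \<in> S i \<rightarrow>\<^sub>E T i"
  shows "(\<lambda>i. compose (S i) (f i) (\<lambda>x\<in>S i. x)) = f"
proof
  show "compose (S i) (f i) (\<lambda>x\<in>S i. x) = f i" for i
    using assms[of i] by (auto simp: PiE_def intro: compose_Id)
qed

lemma levelwise_Id_compose:
  assumes "\<And>i. f i \<in> S i \<rightarrow>\<^sub>E T i"
  shows "(\<lambda>i. compose (S i) (\<lambda>x\<in>T i. x) (f i)) = f"
proof
  show "compose (S i) (\<lambda>x\<in>T i. x) (f i) = f i" for i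
    using assms[of i] by (auto simp: PiE_def intro: Id_compose)
qed

lemma levelwise_compose_assoc:
  assumes "\<And>i. f i \<in> S i \<rightarrow>\<^sub>E T i"
  shows "(\<lambda>i. compose (S i) (h i) (compose (S i) (g i) (f i))) =
    (\<lambda>i. compose (S i) (compose (T i) (h i) (g i)) (f i))"
proof
  show "compose (S i) (h i) (compose (S i) (g i) (f i)) =
      compose (S i) (compose (T i) (h i) (g i)) (f i)" for i
    using assms[of i] by (auto simp: PiE_def intro: compose_assoc)
qed

lemma is_category_filtered_digraph_category: "is_category filtered_digraph_category"
  unfolding is_category_def filtered_digraph_category_def
  by (auto simp: filtered_digraph_morphism_ident filtered_digraph_morphism_compose)
    (auto simp: filtered_digraph_morphism_def digraph_morphism_def
      intro!: levelwise_compose_Id levelwise_Id_compose levelwise_compose_assoc)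

definition continuous_filtered_category ::
  "('a filtered_stratified, nat \<Rightarrow> 'a \<Rightarrow> 'a) cat" where
  "continuous_filtered_category =
     filtered_stratified_arrows\<lparr>hom := \<lambda>F F'. {\<zeta>. continuous_filtered_map F F' \<zeta>}\<rparr>"

lemma is_category_continuous_filtered_category: "is_category continuous_filtered_category"
  unfolding is_category_def continuous_filtered_category_def filtered_stratified_arrows_def
  by (auto simp: continuous_filtered_map_ident continuous_filtered_map_compose)
    (auto simp: continuous_filtered_map_def continuous_stratum_map_def
      intro!: levelwise_compose_Id levelwise_Id_compose levelwise_compose_assoc)

lemma is_functor_filtered_Adj_continuous:
  "is_functor continuous_filtered_category filtered_digraph_category filtered_Adj filtered_Adj_map"
  unfolding is_functor_def
proof (intro conjI)
  show "\<forall>A\<in>obj continuous_filtered_category. filtered_Adj_map A A (ident continuous_filtered_category A) =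
      ident filtered_digraph_category (filtered_Adj A)"
    by (auto simp: continuous_filtered_category_def filtered_stratified_arrows_def
        filtered_digraph_category_def filtered_Adj_map_def filtered_Adj_def Adj_map_ident
        filtered_level)
next
  show "\<forall>A\<in>obj continuous_filtered_category. \<forall>B\<in>obj continuous_filtered_category.
      \<forall>C\<in>obj continuous_filtered_category. \<forall>f\<in>hom continuous_filtered_category A B.
      \<forall>g\<in>hom continuous_filtered_category B C.
      filtered_Adj_map A C (compos continuous_filtered_category A B C g f) =
      compos filtered_digraph_category (filtered_Adj A) (filtered_Adj B) (filtered_Adj C)
        (filtered_Adj_map B C g) (filtered_Adj_map A B f)"
    by (auto simp: continuous_filtered_category_def filtered_stratified_arrows_def
        filtered_digraph_category_def filtered_Adj_def intro: filtered_Adj_map_compose)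
qed (use is_category_continuous_filtered_category is_category_filtered_digraph_category in
    \<open>auto simp: continuous_filtered_category_def filtered_stratified_arrows_def filtered_digraph_category_def
    is_filtered_digraph_filtered_Adj filtered_Adj_map_morphism\<close>)

theorem is_functor_filtered_Adj:
  "is_functor filtered_stratified_category filtered_digraph_category filtered_Adj filtered_Adj_map"
  unfolding filtered_stratified_category_def
proof (rule is_functor_generated_category)
  show "is_functor
      (filtered_stratified_arrows\<lparr>hom := \<lambda>F F'. {\<zeta>. continuous_filtered_map F F' \<zeta>}\<rparr>)
      filtered_digraph_category filtered_Adj filtered_Adj_map"
    using is_functor_filtered_Adj_continuous by (simp add: continuous_filtered_category_def)
qed (auto simp: filtered_stratified_arrows_def filtered_stratified_morphism_def
    continuous_filtered_map_def filtered_level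
    intro: stratified_morphism_imp_continuous_stratum_map)

theorem lemma7:
  shows "is_functor (stratified_category :: ('a stratified, 'a \<Rightarrow> 'a) cat)
           (digraph_category :: ('a set pair_pre_digraph, 'a set \<Rightarrow> 'a set) cat)
           Adj Adj_map \<and>
         is_functor (filtered_stratified_category :: ('a filtered_stratified, nat \<Rightarrow> 'a \<Rightarrow> 'a) cat)
           (filtered_digraph_category :: ('a set filtered_digraph, nat \<Rightarrow> 'a set \<Rightarrow> 'a set) cat)
           filtered_Adj filtered_Adj_map"
  using is_functor_Adj is_functor_filtered_Adj ..

end
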